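(* Let $f:[0,1]\to[0,1]$ be the Tent-map. For any continuous $\xi:[0,1]\to[0,1]$ satisfying $\xi\circ f=f\circ\xi$ there exists a non-degenerate interval $I\subseteq[0,1]$ on which $\xi$ is linear.
   Context: The Tent-map is $f:[0,1]\to[0,1]$, $f(x)=2x$ for $x<1/2$ and $f(x)=2-2x$ for $x\geq 1/2$. A function is called linear on an interval if its graph over this interval is a line segment (i.e. the function is affine there). *)

theory Defs
  imports "HOL-Analysis.Analysis"
begin

(* Only the values on {0..1} are meaningful; tent maps {0..1} into itself. *)
definition tent :: "real \<Rightarrow> real" where
  "tent x = (if x < 1 / 2 then 2 * x else 2 - 2 * x)"

(* "Linear" in the sense that the graph over the interval is a line segment: an additive
   constant is allowed, unlike in the library's predicate linear. *)
definition linear_on_interval :: "(real \<Rightarrow> real) \<Rightarrow> real set \<Rightarrow> bool" where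
  "linear_on_interval g I \<longleftrightarrow> (\<exists>m c. \<forall>x\<in>I. g x = m * x + c)"

end

theory Submission
  imports Defs
begin

text \<open>The increment of \<open>\<xi>\<close> over a dyadic cell of level \<open>n\<close>, multiplied by \<open>2 ^ n\<close>, is
  bounded uniformly in the cell and in \<open>n\<close>: if \<open>\<xi>\<close> varied by more than \<open>2 / 2 ^ n\<close> on a very short
  interval, then \<open>tent ^^ n\<close> would spread the values over all of \<open>{0..1}\<close>, against uniform continuity.
  Moreover \<open>\<xi> 0\<close> and \<open>\<xi> 1\<close> are multiples of \<open>1 / 3\<close>, so these scaled increments all are multiples of \<open>1 / 3\<close>
  as well. A bounded discrete set has a maximum, so some cell attains the largest modulus
  \<open>L\<close>. Then \<open>L\<close> is a Lipschitz constant for \<open>\<xi>\<close>, and on the extremal cell \<open>\<xi>\<close> must be affine.\<close>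

section \<open>Iterates of the tent map and dyadic points\<close>

lemma tent_mem: "x \<in> {0..1} \<Longrightarrow> tent x \<in> {0..1}"
  by (auto simp: tent_def)

lemma tent_pow_mem: "x \<in> {0..1} \<Longrightarrow> (tent ^^ n) x \<in> {0..1}"
  by (induction n) (use tent_mem in auto)

lemma tent_lipschitz: "\<bar>tent x - tent y\<bar> \<le> 2 * \<bar>x - y\<bar>"
  by (auto simp: tent_def abs_if)

lemma tent_pow_lipschitz: "\<bar>(tent ^^ n) x - (tent ^^ n) y\<bar> \<le> 2 ^ n * \<bar>x - y\<bar>"
proof (induction n)
  case (Suc n)
  show ?case using tent_lipschitz[of "(tent ^^ n) x" "(tent ^^ n) y"] Suc by simp
qed simp

text \<open>The numerator \<open>k\<close> becomes \<open>k\<close> on the left half and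
  \<open>2 ^ Suc n - k\<close> on the right half; parity survives because \<open>2 ^ Suc n\<close>
  is even.\<close>

lemma tent_dyadic:
  assumes "k \<le> 2 ^ Suc n"
  obtains j where "j \<le> 2 ^ n" "tent (real k / 2 ^ Suc n) = real j / 2 ^ n" "odd j \<longleftrightarrow> odd k"
proof (cases "k < 2 ^ n")
  case True
  then have "real k < 2 ^ n"
    by (metis of_nat_less_iff of_nat_numeral of_nat_power)
  then have "tent (real k / 2 ^ Suc n) = real k / 2 ^ n"
    by (simp add: tent_def field_simps)
  with True that[of k] show ?thesis by simp
next
  case False
  then have "real k \<ge> 2 ^ n"
    by (metis not_less of_nat_le_iff of_nat_numeral of_nat_power)
  moreover have "real (2 ^ Suc n - k) = 2 ^ Suc n - real k"
    using assms by (simp add: of_nat_diff)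
  ultimately have "tent (real k / 2 ^ Suc n) = real (2 ^ Suc n - k) / 2 ^ n"
    by (simp add: tent_def field_simps)
  moreover have "2 ^ Suc n - k \<le> 2 ^ n" using False by simp
  moreover have "odd (2 ^ Suc n - k) \<longleftrightarrow> odd k" using assms by simp
  ultimately show ?thesis using that by blast
qed

text \<open>Each application lowers the level by one and keeps the parity of the numerator, so after
  \<open>n\<close> steps only the parity is left. Hence neighbouring dyadic points of level
  \<open>n\<close> land on opposite ends of \<open>{0..1}\<close>.\<close>

lemma tent_pow_dyadic: "k \<le> 2 ^ n \<Longrightarrow> (tent ^^ n) (real k / 2 ^ n) = of_bool (odd k)"
proof (induction n arbitrary: k)
  case 0
  then have "k = 0 \<or> k = 1" by auto
  then show ?case by auto
next
  case (Suc n)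
  obtain j where "j \<le> 2 ^ n" "tent (real k / 2 ^ Suc n) = real j / 2 ^ n" "odd j \<longleftrightarrow> odd k"
    using tent_dyadic Suc.prems by blast
  then show ?case using Suc.IH[of j] by (simp only: funpow_Suc_right o_apply)
qed

section \<open>From dyadic cells to real intervals\<close>

lemma dyadic_floor_tendsto: "(\<lambda>n. of_int \<lfloor>2 ^ n * x\<rfloor> / 2 ^ n :: real) \<longlonglongrightarrow> x"
proof (rule tendsto_sandwich)
  have "(\<lambda>n. (1/2::real) ^ n) \<longlonglongrightarrow> 0" by (rule LIMSEQ_realpow_zero) auto
  from tendsto_diff[OF tendsto_const this, of x]
  show "(\<lambda>n. x - (1/2) ^ n) \<longlonglongrightarrow> x" by simp
  show "\<forall>\<^sub>F n in sequentially. x - (1/2) ^ n \<le> of_int \<lfloor>2 ^ n * x\<rfloor> / 2 ^ n"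
  proof (intro always_eventually allI)
    fix n :: nat
    have "2 ^ n * x - 1 \<le> of_int \<lfloor>2 ^ n * x\<rfloor>" by linarith
    then have "(2 ^ n * x - 1) / 2 ^ n \<le> of_int \<lfloor>2 ^ n * x\<rfloor> / 2 ^ n"
      by (rule divide_right_mono) simp
    then show "x - (1/2) ^ n \<le> of_int \<lfloor>2 ^ n * x\<rfloor> / 2 ^ n"
      by (simp add: diff_divide_distrib power_one_over)
  qed
  show "\<forall>\<^sub>F n in sequentially. of_int \<lfloor>2 ^ n * x\<rfloor> / 2 ^ n \<le> x"
  proof (intro always_eventually allI)
    fix n :: nat
    have "of_int \<lfloor>2 ^ n * x\<rfloor> \<le> 2 ^ n * x" by linarith
    then show "of_int \<lfloor>2 ^ n * x\<rfloor> / 2 ^ n \<le> x"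
      by (simp add: field_simps)
  qed
qed simp

text \<open>Adding up cells gives the bound between two dyadic points of one level. Arbitrary
  \<open>x\<close> and \<open>y\<close> are rounded down to level \<open>n\<close>, and continuity
  carries the bound to the limit.\<close>

lemma lipschitz_from_dyadic_cells:
  fixes g :: "real \<Rightarrow> real"
  assumes cont: "continuous_on {0..1} g"
    and cell: "\<And>n i. i < 2 ^ n \<Longrightarrow>
      \<bar>g (real (Suc i) / 2 ^ n) - g (real i / 2 ^ n)\<bar> \<le> L / 2 ^ n"
    and xy: "0 \<le> x" "x \<le> y" "y \<le> 1"
  shows "\<bar>g y - g x\<bar> \<le> L * (y - x)"
proof -
  have chain: "\<bar>g (real (i + d) / 2 ^ n) - g (real i / 2 ^ n)\<bar> \<le> L * (real d / 2 ^ n)"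
    if "i + d \<le> 2 ^ n" for i d n
    using that
  proof (induction d)
    case (Suc d)
    have "L * (real (Suc d) / 2 ^ n) = L * (real d / 2 ^ n) + L / 2 ^ n"
      by (simp add: field_simps)
    with Suc cell[of "i + d" n] show ?case by simp
  qed simp
  define r where "r n z = (of_int \<lfloor>2 ^ n * z\<rfloor> / 2 ^ n :: real)" for n :: nat and z :: real
  have r_lim: "(\<lambda>n. r n z) \<longlonglongrightarrow> z" for z
    unfolding r_def by (rule dyadic_floor_tendsto)
  have r_nat: "r n z = real (nat \<lfloor>2 ^ n * z\<rfloor>) / 2 ^ n" if "0 \<le> z" for n z
    using that by (simp add: r_def)
  have r_le: "nat \<lfloor>2 ^ n * z\<rfloor> \<le> 2 ^ n" if "0 \<le> z" "z \<le> 1" for n and z :: real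
  proof -
    have "\<lfloor>2 ^ n * z\<rfloor> \<le> \<lfloor>2 ^ n :: real\<rfloor>"
      using that by (intro floor_mono) simp
    then have "\<lfloor>2 ^ n * z\<rfloor> \<le> 2 ^ n" by simp
    then show ?thesis by (simp add: nat_le_iff)
  qed
  have r_mem: "r n z \<in> {0..1}" if "z \<in> {0..1}" for n z
  proof -
    have "real (nat \<lfloor>2 ^ n * z\<rfloor>) \<le> real (2 ^ n)" using r_le that by (simp only: of_nat_le_iff) auto
    then show ?thesis using r_nat[of z n] that by (simp del: of_nat_nat)
  qed
  have g_lim: "(\<lambda>n. g (r n z)) \<longlonglongrightarrow> g z" if "z \<in> {0..1}" for z
    by (rule continuous_on_tendsto_compose[OF cont r_lim that]) (use r_mem that in auto)
  have step: "\<bar>g (r n y) - g (r n x)\<bar> \<le> L * (r n y - r n x)" for n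
  proof -
    define i j where "i = nat \<lfloor>2 ^ n * x\<rfloor>" and "j = nat \<lfloor>2 ^ n * y\<rfloor>"
    have "i \<le> j" unfolding i_def j_def
      using xy by (intro nat_mono floor_mono) simp
    moreover have "j \<le> 2 ^ n" using r_le xy by (simp add: j_def)
    moreover have "r n x = real i / 2 ^ n" "r n y = real j / 2 ^ n"
      using r_nat xy by (auto simp: i_def j_def)
    ultimately show ?thesis
      using chain[of i "j - i" n] by (simp add: of_nat_diff diff_divide_distrib)
  qed
  show ?thesis
  proof (rule LIMSEQ_le)
    show "(\<lambda>n. \<bar>g (r n y) - g (r n x)\<bar>) \<longlonglongrightarrow> \<bar>g y - g x\<bar>"
      using g_lim xy by (intro tendsto_intros) auto
    show "(\<lambda>n. L * (r n y - r n x)) \<longlonglongrightarrow> L * (y - x)"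
      by (intro tendsto_intros r_lim)
  qed (use step in blast)
qed

text \<open>The increments over \<open>{a..x}\<close> and \<open>{x..b}\<close> add up to the
  extremal one, so neither can fall short of its own bound and both have the same sign.\<close>

lemma affine_if_extremal_lipschitz:
  fixes g :: "real \<Rightarrow> real"
  assumes lip: "\<And>x y. \<lbrakk>a \<le> x; x \<le> y; y \<le> b\<rbrakk> \<Longrightarrow> \<bar>g y - g x\<bar> \<le> L * (y - x)"
    and ext: "\<bar>g b - g a\<bar> = L * (b - a)"
  shows "linear_on_interval g {a..b}"
proof -
  define m where "m = (if g b \<ge> g a then L else - L)"
  have "g x = m * x + (g a - m * a)" if "x \<in> {a..b}" for x
    using lip[of a x] lip[of x b] ext that
    by (auto simp: m_def algebra_simps split: if_splits)
  then show ?thesis unfolding linear_on_interval_def by blast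
qed

lemma dyadic_neighbours_between:
  fixes u v :: real
  assumes "0 \<le> u" "u + 2 / 2 ^ n \<le> v"
  obtains k :: nat where "u \<le> real k / 2 ^ n" "real (Suc k) / 2 ^ n \<le> v"
proof
  \<comment> \<open>Rounding up loses at most one cell width, and the right neighbour takes another;
    this is the gap of \<open>2 / 2 ^ n\<close>.\<close>
  define k where "k = nat \<lceil>2 ^ n * u\<rceil>"
  have k: "real k = of_int \<lceil>2 ^ n * u\<rceil>"
    using assms(1) by (simp add: k_def)
  have lo: "2 ^ n * u \<le> real k" and hi: "real k \<le> 2 ^ n * u + 1"
    unfolding k by linarith+
  have "2 ^ n * u + 2 \<le> 2 ^ n * v"
    using assms(2) by (simp add: field_simps)
  with lo hi show "u \<le> real k / 2 ^ n" "real (Suc k) / 2 ^ n \<le> v"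
    by (simp_all add: field_simps)
qed

section \<open>Continuous self-maps commuting with the tent map\<close>

context
  fixes \<xi> :: "real \<Rightarrow> real"
  assumes cont: "continuous_on {0..1} \<xi>"
    and range: "\<xi> ` {0..1} \<subseteq> {0..1}"
    and commute: "\<forall>x\<in>{0..1}. \<xi> (tent x) = tent (\<xi> x)"
begin

lemma value_mem: "x \<in> {0..1} \<Longrightarrow> \<xi> x \<in> {0..1}"
  using range by blast

lemma commute_tent_pow: "x \<in> {0..1} \<Longrightarrow> \<xi> ((tent ^^ n) x) = (tent ^^ n) (\<xi> x)"
  by (induction n) (use commute tent_pow_mem in auto)

text \<open>Otherwise the values on \<open>{x..y}\<close> include two neighbouring dyadic points of
  level \<open>n\<close>, which \<open>tent ^^ n\<close> sends to 0 and 1. By commutation,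
  \<open>\<xi>\<close> then differs by 1 at two points at distance at most
  \<open>\<delta>\<close>.\<close>

lemma small_increment:
  assumes unif: "\<And>x y. \<lbrakk>x \<in> {0..1}; y \<in> {0..1}; \<bar>x - y\<bar> \<le> \<delta>\<rbrakk> \<Longrightarrow> \<bar>\<xi> x - \<xi> y\<bar> < 1"
    and xy: "0 \<le> x" "x \<le> y" "y \<le> 1" "2 ^ n * (y - x) \<le> \<delta>"
  shows "\<bar>\<xi> y - \<xi> x\<bar> \<le> 2 / 2 ^ n"
proof (rule ccontr)
  assume "\<not> ?thesis"
  moreover define u v where "u = min (\<xi> x) (\<xi> y)" and "v = max (\<xi> x) (\<xi> y)"
  ultimately have uv: "u + 2 / 2 ^ n \<le> v" by (auto simp: u_def v_def)
  have mem: "\<xi> x \<in> {0..1}" "\<xi> y \<in> {0..1}" using value_mem xy by auto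
  then have "0 \<le> u" "v \<le> 1" by (auto simp: u_def v_def)
  obtain k where k: "u \<le> real k / 2 ^ n" "real (Suc k) / 2 ^ n \<le> v"
    using dyadic_neighbours_between[OF \<open>0 \<le> u\<close> uv] .
  have hit: "\<exists>z. x \<le> z \<and> z \<le> y \<and> \<xi> z = w" if "u \<le> w" "w \<le> v" for w
  proof -
    have c: "continuous_on {x..y} \<xi>"
      using cont by (rule continuous_on_subset) (use xy in auto)
    show ?thesis
    proof (cases "\<xi> x \<le> \<xi> y")
      case True
      with that show ?thesis
        using IVT'[OF _ _ \<open>x \<le> y\<close> c, of w] by (auto simp: u_def v_def)
    next
      case False
      with that show ?thesis
        using IVT2'[OF _ _ \<open>x \<le> y\<close> c, of w] by (auto simp: u_def v_def)
    qed
  qed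
  have "real k / 2 ^ n \<le> real (Suc k) / 2 ^ n" by (simp add: divide_right_mono)
  then obtain z z' where z: "x \<le> z" "z \<le> y" "\<xi> z = real k / 2 ^ n"
    and z': "x \<le> z'" "z' \<le> y" "\<xi> z' = real (Suc k) / 2 ^ n"
    using hit[of "real k / 2 ^ n"] hit[of "real (Suc k) / 2 ^ n"] k by force
  have "real (Suc k) / 2 ^ n \<le> 1" using k(2) \<open>v \<le> 1\<close> by linarith
  then have "real (Suc k) \<le> real (2 ^ n)" by (simp add: divide_simps)
  then have "Suc k \<le> 2 ^ n" by (simp only: of_nat_le_iff)
  then have "(tent ^^ n) (\<xi> z) = of_bool (odd k)" "(tent ^^ n) (\<xi> z') = of_bool (odd (Suc k))"
    unfolding z z' by (intro tent_pow_dyadic; simp)+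
  moreover have zm: "z \<in> {0..1}" "z' \<in> {0..1}" using z z' xy by auto
  \<comment> \<open>\<open>k\<close> and \<open>Suc k\<close> have opposite parity, so one value is
    0 and the other is 1.\<close>
  ultimately have "\<bar>\<xi> ((tent ^^ n) z) - \<xi> ((tent ^^ n) z')\<bar> = 1"
    by (simp add: commute_tent_pow)
  moreover have "\<bar>(tent ^^ n) z - (tent ^^ n) z'\<bar> \<le> \<delta>"
  proof -
    have "\<bar>z - z'\<bar> \<le> y - x" using z z' by linarith
    then have "2 ^ n * \<bar>z - z'\<bar> \<le> 2 ^ n * (y - x)" by simp
    with tent_pow_lipschitz[of n z z'] xy(4) show ?thesis by linarith
  qed
  ultimately show False
    using unif[OF tent_pow_mem[OF zm(1)] tent_pow_mem[OF zm(2)]] by fastforce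
qed

lemma dyadic_cell_right_le_one: "i < 2 ^ n \<Longrightarrow> real (Suc i) / 2 ^ n \<le> 1"
proof -
  assume "i < 2 ^ n"
  then have "real (Suc i) \<le> real (2 ^ n)" by (simp only: of_nat_le_iff Suc_le_eq)
  then show ?thesis by (simp add: divide_simps)
qed

lemma scaled_increment_bounded:
  obtains K where "\<And>n i. i < 2 ^ n \<Longrightarrow>
    2 ^ n * \<bar>\<xi> (real (Suc i) / 2 ^ n) - \<xi> (real i / 2 ^ n)\<bar> \<le> K"
proof -
  have "uniformly_continuous_on {0..1} \<xi>"
    using cont by (intro compact_uniformly_continuous) auto
  then obtain d where "d > 0"
    and d: "\<And>x y. \<lbrakk>x \<in> {0..1}; y \<in> {0..1}; dist y x < d\<rbrakk> \<Longrightarrow> dist (\<xi> y) (\<xi> x) < 1"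
    unfolding uniformly_continuous_on_def by (meson zero_less_one)
  obtain N where N: "(1/2) ^ N < d"
    using real_arch_pow_inv[of d "1/2"] \<open>d > 0\<close> by auto
  have unif: "\<bar>\<xi> x - \<xi> y\<bar> < 1"
    if "x \<in> {0..1}" "y \<in> {0..1}" "\<bar>x - y\<bar> \<le> (1/2) ^ N" for x y
    using d[of y x] that N by (simp add: dist_real_def)
  show ?thesis
  proof
    fix n i :: nat
    assume i: "i < 2 ^ n"
    define x y where "x = real i / 2 ^ n" and "y = real (Suc i) / 2 ^ n"
    have xy: "0 \<le> x" "x \<le> y" "y \<le> 1" "y - x = 1 / 2 ^ n"
      using dyadic_cell_right_le_one[OF i] by (auto simp: x_def y_def divide_simps)
    have "2 ^ n * \<bar>\<xi> y - \<xi> x\<bar> \<le> 2 * 2 ^ N"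
    \<comment> \<open>Up to level \<open>N\<close> the trivial bound 1 on the increment is enough;
      beyond it the cell is short enough to be stretched by some iterates first.\<close>
    proof (cases "n \<le> N")
      case True
      have "\<bar>\<xi> y - \<xi> x\<bar> \<le> 1" using value_mem[of x] value_mem[of y] xy by (auto simp: abs_le_iff)
      moreover have "(2::real) ^ n \<le> 2 ^ N" using True by simp
      ultimately have "2 ^ n * \<bar>\<xi> y - \<xi> x\<bar> \<le> 2 ^ N * 1" by (intro mult_mono) auto
      also have "\<dots> \<le> 2 * 2 ^ N" by simp
      finally show ?thesis .
    next
      case False
      then obtain m where m: "n = m + N" by (metis add.commute le_add_diff_inverse linear)
      \<comment> \<open>Stretching by \<open>2 ^ m\<close> turns a cell of level
        \<open>n = m + N\<close> into length \<open>(1/2) ^ N\<close>, the scale of uniform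
        continuity.\<close>
      have "2 ^ m * (y - x) \<le> (1/2) ^ N"
        using xy by (simp add: m power_add power_divide)
      from small_increment[OF unif xy(1-3) this] have "\<bar>\<xi> y - \<xi> x\<bar> \<le> 2 / 2 ^ m" .
      then show ?thesis by (simp add: m power_add field_simps)
    qed
    then show "2 ^ n * \<bar>\<xi> (real (Suc i) / 2 ^ n) - \<xi> (real i / 2 ^ n)\<bar> \<le> 2 * 2 ^ N"
      by (simp only: x_def y_def)
  qed
qed

text \<open>The value at 0 is a fixed point of \<open>tent\<close> and the value at 1 is a preimage
  of it, which settles level 0. Each further level inverts one branch of \<open>tent\<close>,
  costing a single factor 2 in the denominator.\<close>

lemma dyadic_value_third_integer:
  "i \<le> 2 ^ n \<Longrightarrow> 3 * 2 ^ n * \<xi> (real i / 2 ^ n) \<in> \<int>"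
proof (induction n arbitrary: i)
  case 0
  have "tent (\<xi> 0) = \<xi> 0" "tent (\<xi> 1) = \<xi> 0"
    using commute[rule_format, of 0] commute[rule_format, of 1] tent_def[of 0] tent_def[of 1]
    by simp_all
  \<comment> \<open>The fixed points of \<open>tent\<close> are 0 and 2/3; this is where the factor
    3 originates.\<close>
  moreover from this(1) have zero: "3 * \<xi> 0 = 0 \<or> 3 * \<xi> 0 = 2"
    by (auto simp: tent_def split: if_splits)
  ultimately have "3 * \<xi> 1 = 0 \<or> 3 * \<xi> 1 = 1 \<or> 3 * \<xi> 1 = 2 \<or> 3 * \<xi> 1 = 3"
    by (simp add: tent_def split: if_splits)
  with zero have "3 * \<xi> 0 \<in> \<int>" "3 * \<xi> 1 \<in> \<int>" by (auto simp: Ints_def)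
  moreover have "i = 0 \<or> i = 1" using 0 by auto
  ultimately show ?case by auto
next
  case (Suc n)
  define x where "x = real i / 2 ^ Suc n"
  have "real i \<le> real (2 ^ Suc n)" using Suc.prems by (simp only: of_nat_le_iff)
  then have "x \<in> {0..1}" by (simp add: x_def divide_simps)
  then have c: "\<xi> (tent x) = tent (\<xi> x)" using commute by blast
  obtain j where "j \<le> 2 ^ n" "tent x = real j / 2 ^ n"
    using tent_dyadic Suc.prems unfolding x_def by metis
  with Suc.IH[of j] c have "3 * 2 ^ n * tent (\<xi> x) \<in> \<int>" by simp
  \<comment> \<open>With \<open>t = tent (\<xi> x)\<close>, the two inverse branches give
    \<open>\<xi> x = t / 2\<close> or \<open>\<xi> x = 1 - t / 2\<close>.\<close>
  moreover have "3 * 2 ^ Suc n * \<xi> x = 3 * 2 ^ n * tent (\<xi> x) \<or>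
      3 * 2 ^ Suc n * \<xi> x = 3 * 2 ^ Suc n - 3 * 2 ^ n * tent (\<xi> x)"
    by (auto simp: tent_def algebra_simps)
  moreover have "(3 * 2 ^ Suc n :: real) \<in> \<int>" by (intro Ints_mult Ints_power) auto
  ultimately show ?case unfolding x_def[symmetric] by (metis Ints_diff)
qed

lemma maximal_scaled_increment:
  obtains n i where "i < 2 ^ n"
    "\<And>m j. j < 2 ^ m \<Longrightarrow> 2 ^ m * \<bar>\<xi> (real (Suc j) / 2 ^ m) - \<xi> (real j / 2 ^ m)\<bar>
      \<le> 2 ^ n * \<bar>\<xi> (real (Suc i) / 2 ^ n) - \<xi> (real i / 2 ^ n)\<bar>"
proof -
  define D where "D = (\<lambda>(n, i). 2 ^ n * \<bar>\<xi> (real (Suc i) / 2 ^ n) - \<xi> (real i / 2 ^ n)\<bar>)"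
  define C where "C = {(n, i). i < (2::nat) ^ n}"
  obtain K where K: "\<And>p. p \<in> C \<Longrightarrow> D p \<le> K"
    using scaled_increment_bounded by (auto simp: D_def C_def)
  have int: "3 * D p \<in> \<int>" if p_mem: "p \<in> C" for p
  proof -
    obtain n i where p: "p = (n, i)" "i < 2 ^ n" using p_mem by (auto simp: C_def)
    have "3 * D p = \<bar>3 * 2 ^ n * \<xi> (real (Suc i) / 2 ^ n) - 3 * 2 ^ n * \<xi> (real i / 2 ^ n)\<bar>"
      by (simp add: D_def p(1) abs_mult flip: right_diff_distrib)
    also have "\<dots> \<in> \<int>"
      using p(2) by (intro Ints_abs Ints_diff dyadic_value_third_integer) auto
    finally show ?thesis .
  qed
  \<comment> \<open>Three times a scaled increment is a nonnegative integer, so maximality reduces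
    to a bounded function with values in \<open>nat\<close>, taken over all levels at once.\<close>
  define f where "f p = nat \<lfloor>3 * D p\<rfloor>" for p
  have f: "real (f p) = 3 * D p" if "p \<in> C" for p
    using int[OF that] by (auto simp: f_def D_def split: prod.splits elim!: Ints_cases)
  have "f p \<le> nat \<lceil>3 * K\<rceil>" if "p \<in> C" for p
  proof -
    have "real (f p) \<le> 3 * K" using f[OF that] K[OF that] by simp
    then show ?thesis by linarith
  qed
  moreover have "(0, 0) \<in> C" by (simp add: C_def)
  ultimately obtain p where p: "p \<in> C" "\<And>q. q \<in> C \<Longrightarrow> f q \<le> f p"
    using ex_has_greatest_nat[of "\<lambda>p. p \<in> C" "(0, 0)" f] by (metis le_imp_less_Suc)
  have "D q \<le> D p" if "q \<in> C" for q
    using p(2)[OF that] f[OF that] f[OF p(1)] by linarith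
  with p(1) show ?thesis
    by (cases p) (intro that; auto simp: C_def D_def)
qed

lemma affine_on_some_interval:
  "\<exists>a b. a < b \<and> {a..b} \<subseteq> {0..1} \<and> linear_on_interval \<xi> {a..b}"
proof -
  obtain n i where i: "i < 2 ^ n"
    and max: "\<And>m j. j < 2 ^ m \<Longrightarrow>
      2 ^ m * \<bar>\<xi> (real (Suc j) / 2 ^ m) - \<xi> (real j / 2 ^ m)\<bar>
      \<le> 2 ^ n * \<bar>\<xi> (real (Suc i) / 2 ^ n) - \<xi> (real i / 2 ^ n)\<bar>"
    by (rule maximal_scaled_increment, rule that)
  define a b where "a = real i / 2 ^ n" and "b = real (Suc i) / 2 ^ n"
  define L where "L = 2 ^ n * \<bar>\<xi> b - \<xi> a\<bar>"
  have ab: "0 \<le> a" "b \<le> 1" "b - a = 1 / 2 ^ n"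
    using dyadic_cell_right_le_one[OF i] by (auto simp: a_def b_def divide_simps)
  have "a < b" by (simp add: a_def b_def divide_strict_right_mono)
  \<comment> \<open>Maximality over every level makes \<open>L\<close> a slope bound on all dyadic
    cells, attained on \<open>{a..b}\<close>.\<close>
  have cell: "\<bar>\<xi> (real (Suc j) / 2 ^ m) - \<xi> (real j / 2 ^ m)\<bar> \<le> L / 2 ^ m" if "j < 2 ^ m" for m j
    using max[OF that] by (simp add: L_def a_def b_def field_simps)
  have "linear_on_interval \<xi> {a..b}"
  proof (rule affine_if_extremal_lipschitz)
    show "\<bar>\<xi> b - \<xi> a\<bar> = L * (b - a)" by (simp add: L_def ab(3))
    show "\<bar>\<xi> y - \<xi> x\<bar> \<le> L * (y - x)" if "a \<le> x" "x \<le> y" "y \<le> b" for x y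
      using lipschitz_from_dyadic_cells[OF cont cell] that ab by simp
  qed
  with \<open>a < b\<close> ab show ?thesis by (intro exI[of _ a] exI[of _ b]) auto
qed

end

theorem theorem2:
  fixes \<xi> :: "real \<Rightarrow> real"
  assumes "continuous_on {0..1} \<xi>"
    and "\<xi> ` {0..1} \<subseteq> {0..1}"
    and "\<forall>x\<in>{0..1}. \<xi> (tent x) = tent (\<xi> x)"
  shows "\<exists>a b. a < b \<and> {a..b} \<subseteq> {0..1} \<and> linear_on_interval \<xi> {a..b}"
  using affine_on_some_interval[OF assms] .

end
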